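(* Let $X_1$ be a separable Banach space, $X_2$ a closed subspace of $X_1$, $(E_n,F_n)$ a paving for $(X_1,X_2)$, and let $\lambda\ge1$. The following are equivalent: (i) $(X_1,X_2)$ has the $\lambda$-BAP. (ii) The pair of short exact sequences $$0\to c_0(E_n)\xrightarrow{j_1}c(E_n)\xrightarrow{q_1}X_1\to0,\qquad 0\to c_0(F_n)\xrightarrow{j_2}c(F_n)\xrightarrow{q_2}X_2\to0$$ (the second included in the first by the natural isometric embeddings) admits a simultaneous linear lifting of norm at most $\lambda$; that is, there is a bounded linear map $L:X_1\to c(E_n)$ with $q_1\circ L=\mathrm{Id}_{X_1}$, $L(X_2)\subseteq c(F_n)$ and $\|L\|\le\lambda$.
   Context: A paving of $(X_1,X_2)$ is a sequence $(E_n,F_n)$ where $(E_n)$ is an increasing sequence of finite-dimensional subspaces of $X_1$ with union dense in $X_1$, $(F_n)$ is an increasing sequence of finite-dimensional subspaces of $X_2$ with union dense in $X_2$, and $F_n\subseteq E_n$ for all $n$. $c(E_n)=\{(x_n): x_n\in E_n \text{ for each } n,\ (x_n)\text{ converges}\}$ and $c_0(E_n)=\{(x_n): x_n\in E_n\text{ for each } n,\ \lim_n x_n=0\}$, with the supremum norm; similarly for $(F_n)$. The maps $j_1,j_2$ are the natural inclusions and $q_1,q_2$ send a sequence to its limit. The pair $(X_1,X_2)$ has the $\lambda$-BAP if for each $\varepsilon>0$ and each compact $K\subset X_1$ there is a finite-rank linear map $S:X_1\to X_1$ with $\|S\|\le\lambda$, $\|S(x)-x\|\le\varepsilon$ for each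 $x\in K$, and $S(X_2)\subseteq X_2$. *)

theory Defs
  imports "HOL-Analysis.Analysis"
begin

section \<open>Pavings and the bounded approximation property for pairs\<close>

definition finite_dim_subspace :: "'a::real_vector set \<Rightarrow> bool" where
  "finite_dim_subspace V \<longleftrightarrow> (\<exists>B. finite B \<and> span B = V)"

definition fd_exhaustion :: "'a::real_normed_vector set \<Rightarrow> (nat \<Rightarrow> 'a set) \<Rightarrow> bool" where
  "fd_exhaustion X V \<longleftrightarrow>
     (\<forall>n. finite_dim_subspace (V n)) \<and> incseq V \<and>
     (\<Union>n. V n) \<subseteq> X \<and> X \<subseteq> closure (\<Union>n. V n)"

definition paving ::
  "'a::real_normed_vector set \<Rightarrow> 'a set \<Rightarrow> (nat \<Rightarrow> 'a set) \<Rightarrow> (nat \<Rightarrow> 'a set) \<Rightarrow> bool" where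
  "paving X1 X2 E F \<longleftrightarrow> fd_exhaustion X1 E \<and> fd_exhaustion X2 F \<and> (\<forall>n. F n \<subseteq> E n)"

text \<open>Here the ambient space $X_1$ is the whole type, so that the operator norm of a map on
  $X_1$ is \<^const>\<open>onorm\<close>.  That constant is meaningful for bounded linear maps only, which is why
  boundedness is listed next to each norm estimate.\<close>

definition has_BAP_pair :: "real \<Rightarrow> 'a::real_normed_vector set \<Rightarrow> bool" where
  "has_BAP_pair lam X2 \<longleftrightarrow>
     (\<forall>\<epsilon>>0. \<forall>K. compact K \<longrightarrow>
        (\<exists>S :: 'a \<Rightarrow> 'a. bounded_linear S \<and> finite_dim_subspace (range S) \<and> onorm S \<le> lam \<and>
           (\<forall>x\<in>K. norm (S x - x) \<le> \<epsilon>) \<and> S ` X2 \<subseteq> X2))"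

section \<open>The sequence spaces\<close>

text \<open>Convergent sequences are bounded, so both spaces are subspaces of
  \<^typ>\<open>nat \<Rightarrow>\<^sub>C 'a\<close>: as \<^typ>\<open>nat\<close> is discrete, this is the space of all bounded sequences,
  and its norm is the supremum norm.\<close>

definition c_space :: "(nat \<Rightarrow> 'a::real_normed_vector set) \<Rightarrow> (nat \<Rightarrow>\<^sub>C 'a) set" where
  "c_space V = {x. (\<forall>n. apply_bcontfun x n \<in> V n) \<and> convergent (apply_bcontfun x)}"

definition c0_space :: "(nat \<Rightarrow> 'a::real_normed_vector set) \<Rightarrow> (nat \<Rightarrow>\<^sub>C 'a) set" where
  "c0_space V = {x. (\<forall>n. apply_bcontfun x n \<in> V n) \<and> apply_bcontfun x \<longlonglongrightarrow> 0}"

definition lim_map :: "(nat \<Rightarrow>\<^sub>C 'a::real_normed_vector) \<Rightarrow> 'a" where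
  "lim_map x = lim (apply_bcontfun x)"

section \<open>Short exact sequences and simultaneous liftings\<close>

definition bounded_linear_between ::
  "'a::real_normed_vector set \<Rightarrow> 'b::real_normed_vector set \<Rightarrow> ('a \<Rightarrow> 'b) \<Rightarrow> bool" where
  "bounded_linear_between V W f \<longleftrightarrow>
     f ` V \<subseteq> W \<and>
     (\<forall>x\<in>V. \<forall>y\<in>V. f (x + y) = f x + f y) \<and>
     (\<forall>r. \<forall>x\<in>V. f (r *\<^sub>R x) = r *\<^sub>R f x) \<and>
     (\<exists>C. \<forall>x\<in>V. norm (f x) \<le> C * norm x)"

definition banach_subspace :: "'a::real_normed_vector set \<Rightarrow> bool" where
  "banach_subspace V \<longleftrightarrow> subspace V \<and> complete V"

definition short_exact ::
  "('y::real_normed_vector \<Rightarrow> 'z::real_normed_vector) \<Rightarrow> ('z \<Rightarrow> 'x::real_normed_vector) \<Rightarrow>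
   'y set \<Rightarrow> 'z set \<Rightarrow> 'x set \<Rightarrow> bool" where
  "short_exact j q Y Z X \<longleftrightarrow>
     banach_subspace Y \<and> banach_subspace Z \<and> banach_subspace X \<and>
     bounded_linear_between Y Z j \<and> bounded_linear_between Z X q \<and>
     inj_on j Y \<and> j ` Y = {z \<in> Z. q z = 0} \<and> q ` Z = X"

text \<open>The second sequence is included in the first one by set inclusions, which are isometric; the
  maps of the second sequence are then the restrictions of those of the first.  The space $X_1$ on
  which a lifting is defined is the whole type.\<close>

definition admits_simultaneous_lifting ::
  "real \<Rightarrow> ('y::real_normed_vector \<Rightarrow> 'z::real_normed_vector) \<Rightarrow> ('z \<Rightarrow> 'x::real_normed_vector) \<Rightarrow>
   'y set \<Rightarrow> 'z set \<Rightarrow> 'y set \<Rightarrow> 'z set \<Rightarrow> 'x set \<Rightarrow> bool" where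
  "admits_simultaneous_lifting lam j q Y1 Z1 Y2 Z2 X2 \<longleftrightarrow>
     short_exact j q Y1 Z1 UNIV \<and> short_exact j q Y2 Z2 X2 \<and> Y2 \<subseteq> Y1 \<and> Z2 \<subseteq> Z1 \<and>
     (\<exists>L :: 'x \<Rightarrow> 'z. bounded_linear L \<and> range L \<subseteq> Z1 \<and> (\<forall>x. q (L x) = x) \<and>
        L ` X2 \<subseteq> Z2 \<and> onorm L \<le> lam)"

section \<open>Exactness of the sequences associated with a paving\<close>

lemma complete_span_insert:
  fixes V :: "'a::real_normed_vector set"
  assumes V: "subspace V" "complete V"
  shows "complete (span (insert b V))"
proof (cases "b \<in> V")
  case True
  then show ?thesis
    using V by (metis insert_absorb span_eq_iff)
next
  case False
  have "closed V"
    using V(2) by (rule complete_imp_closed)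
  then obtain d where d: "d > 0" "ball b d \<subseteq> - V"
    using False by (metis ComplI Compl_iff open_Compl openE)
  have bound: "\<bar>k\<bar> * d \<le> norm (v + k *\<^sub>R b)" if "v \<in> V" for v k
  proof (cases "k = 0")
    case False
    have "- (1 / k) *\<^sub>R v \<in> V"
      using V(1) that by (rule subspace_scale)
    then have "- (1 / k) *\<^sub>R v \<notin> ball b d"
      using d(2) by auto
    then have "d \<le> norm (b + (1 / k) *\<^sub>R v)"
      by (simp add: dist_norm)
    then have "\<bar>k\<bar> * d \<le> \<bar>k\<bar> * norm (b + (1 / k) *\<^sub>R v)"
      by (rule mult_left_mono) simp
    also have "\<dots> = norm (k *\<^sub>R (b + (1 / k) *\<^sub>R v))"
      by simp
    also have "k *\<^sub>R (b + (1 / k) *\<^sub>R v) = v + k *\<^sub>R b"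
      using False by (simp add: scaleR_add_right)
    finally show ?thesis .
  qed simp
  show ?thesis
    unfolding complete_def
  proof (intro allI impI, elim conjE)
    fix s :: "nat \<Rightarrow> 'a"
    assume s: "\<forall>n. s n \<in> span (insert b V)" and "Cauchy s"
    have "\<forall>n. \<exists>k. s n - k *\<^sub>R b \<in> V"
      using s V(1) by (metis span_breakdown_eq span_eq_iff)
    then obtain k where k: "\<And>n. s n - k n *\<^sub>R b \<in> V"
      by metis
    have le: "\<bar>k m - k n\<bar> * d \<le> norm (s m - s n)" for m n
      using bound[OF subspace_diff[OF V(1) k[of m] k[of n]], of "k m - k n"]
      by (simp add: algebra_simps)
    have "Cauchy k"
    proof (rule metric_CauchyI)
      fix e :: real assume "e > 0"
      then obtain M where M: "\<forall>m\<ge>M. \<forall>n\<ge>M. dist (s m) (s n) < e * d"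
        using \<open>Cauchy s\<close> d(1) metric_CauchyD[of s "e * d"] by auto
      have "dist (k m) (k n) < e" if "m \<ge> M" "n \<ge> M" for m n
      proof -
        have "\<bar>k m - k n\<bar> * d < e * d"
          using le[of m n] M that by (force simp: dist_norm)
        then show ?thesis
          using d(1) by (simp add: dist_real_def)
      qed
      then show "\<exists>M. \<forall>m\<ge>M. \<forall>n\<ge>M. dist (k m) (k n) < e"
        by blast
    qed
    then obtain k0 where k0: "k \<longlonglongrightarrow> k0"
      using real_Cauchy_convergent convergent_def by blast
    then have kb: "(\<lambda>n. k n *\<^sub>R b) \<longlonglongrightarrow> k0 *\<^sub>R b"
      by (intro tendsto_intros)
    have "Cauchy (\<lambda>n. s n - k n *\<^sub>R b)"
    proof (rule metric_CauchyI)
      fix e :: real assume "e > 0"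
      then have "e / 2 > 0" by simp
      obtain M where M: "\<And>m n. m \<ge> M \<Longrightarrow> n \<ge> M \<Longrightarrow> dist (s m) (s n) < e / 2"
        using metric_CauchyD[OF \<open>Cauchy s\<close> \<open>e / 2 > 0\<close>] by blast
      obtain N where N: "\<And>m n. m \<ge> N \<Longrightarrow> n \<ge> N \<Longrightarrow> dist (k m *\<^sub>R b) (k n *\<^sub>R b) < e / 2"
        using metric_CauchyD[OF LIMSEQ_imp_Cauchy[OF kb] \<open>e / 2 > 0\<close>] by blast
      have "dist (s m - k m *\<^sub>R b) (s n - k n *\<^sub>R b) < e" if "m \<ge> max M N" "n \<ge> max M N" for m n
        using norm_diff_triangle_ineq[of "s m" "- (k m *\<^sub>R b)" "s n" "- (k n *\<^sub>R b)"]
          M[of m n] N[of m n] that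
        by (simp add: dist_norm norm_minus_commute)
      then show "\<exists>M. \<forall>m\<ge>M. \<forall>n\<ge>M. dist (s m - k m *\<^sub>R b) (s n - k n *\<^sub>R b) < e"
        by blast
    qed
    then obtain w where w: "w \<in> V" "(\<lambda>n. s n - k n *\<^sub>R b) \<longlonglongrightarrow> w"
      using V(2)[unfolded complete_def, rule_format, of "\<lambda>n. s n - k n *\<^sub>R b"] k by metis
    have "s \<longlonglongrightarrow> w + k0 *\<^sub>R b"
      using tendsto_add[OF w(2) kb] by simp
    moreover have "w + k0 *\<^sub>R b \<in> span (insert b V)"
      using w(1) by (simp add: span_add span_base span_scale)
    ultimately show "\<exists>l\<in>span (insert b V). s \<longlonglongrightarrow> l"
      by blast
  qed
qed

lemma finite_dim_subspaceD:
  fixes V :: "'a::real_normed_vector set"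
  assumes "finite_dim_subspace V"
  shows "subspace V" "complete V" "closed V"
proof -
  obtain B where B: "finite B" "span B = V"
    using assms unfolding finite_dim_subspace_def by blast
  show "subspace V"
    using B(2) by auto
  have "complete (span B)"
    using B(1)
  proof (induction B)
    case empty
    show ?case by (simp add: compact_imp_complete)
  next
    case (insert b B)
    have "complete (span (insert b (span B)))"
      using insert.IH by (intro complete_span_insert) auto
    moreover have "span (insert b (span B)) = span (insert b B)"
      by (auto simp: span_breakdown_eq span_span)
    ultimately show ?case by simp
  qed
  then show "complete V" "closed V"
    using B(2) complete_imp_closed by auto
qed

lemma lim_mapI:
  "apply_bcontfun x \<longlonglongrightarrow> l \<Longrightarrow> lim_map x = l"
  unfolding lim_map_def by (rule limI)

lemma c_spaceD:
  assumes "x \<in> c_space V"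
  shows "apply_bcontfun x \<longlonglongrightarrow> lim_map x"
  using assms unfolding c_space_def lim_map_def by (simp add: convergent_LIMSEQ_iff)

lemma c0_space_eq: "c0_space V = {x \<in> c_space V. lim_map x = 0}"
proof (intro set_eqI iffI)
  fix x assume "x \<in> c0_space V"
  then show "x \<in> {x \<in> c_space V. lim_map x = 0}"
    using convergentI[of "apply_bcontfun x" 0] lim_mapI[of x 0]
    by (simp add: c0_space_def c_space_def)
next
  fix x assume "x \<in> {x \<in> c_space V. lim_map x = 0}"
  then show "x \<in> c0_space V"
    using c_spaceD[of x V] unfolding c0_space_def c_space_def by fastforce
qed

lemma c_space_linear:
  assumes "x \<in> c_space V" "y \<in> c_space V"
  shows "lim_map (x + y) = lim_map x + lim_map y" "lim_map (r *\<^sub>R x) = r *\<^sub>R lim_map x"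
    and "norm (lim_map x) \<le> norm x"
proof -
  note x = c_spaceD[OF assms(1)] and y = c_spaceD[OF assms(2)]
  show "lim_map (x + y) = lim_map x + lim_map y"
    using tendsto_add[OF x y] by (intro lim_mapI) simp
  show "lim_map (r *\<^sub>R x) = r *\<^sub>R lim_map x"
    using tendsto_scaleR[OF tendsto_const[of r] x]
    by (intro lim_mapI) simp
  show "norm (lim_map x) \<le> norm x"
    using norm_bounded[of x] by (intro Lim_norm_ubound[OF _ x]) auto
qed

lemma lim_map_diff:
  assumes "x \<in> c_space V" "y \<in> c_space V"
  shows "norm (lim_map x - lim_map y) \<le> norm (x - y)"
proof -
  have "(\<lambda>n. apply_bcontfun (x - y) n) \<longlonglongrightarrow> lim_map x - lim_map y"
    using tendsto_diff[OF c_spaceD[OF assms(1)] c_spaceD[OF assms(2)]]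
    by simp
  then show ?thesis
    using norm_bounded[of "x - y"] by (intro Lim_norm_ubound) auto
qed

lemma subspace_c_space:
  fixes V :: "nat \<Rightarrow> 'a::real_normed_vector set"
  assumes "\<And>n. subspace (V n)"
  shows "subspace (c_space V)"
proof -
  have "convergent (\<lambda>n. r *\<^sub>R apply_bcontfun x n)" if "convergent (apply_bcontfun x)"
    for r and x :: "nat \<Rightarrow>\<^sub>C 'a"
    using that tendsto_scaleR[OF tendsto_const] unfolding convergent_def by blast
  then show ?thesis
    using assms unfolding subspace_def c_space_def
    by (simp add: convergent_const convergent_add)
qed

lemma complete_c_space:
  fixes V :: "nat \<Rightarrow> 'a::banach set"
  assumes "\<And>n. closed (V n)"
  shows "complete (c_space V)"
  unfolding complete_def
proof (intro allI impI, elim conjE)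
  fix s :: "nat \<Rightarrow> nat \<Rightarrow>\<^sub>C 'a"
  assume s: "\<forall>k. s k \<in> c_space V" and "Cauchy s"
  obtain g where "uniform_limit UNIV (\<lambda>k. apply_bcontfun (s k)) g sequentially"
    using \<open>Cauchy s\<close> uniformly_convergent_eq_cauchy[of "\<lambda>_. True" "\<lambda>k. apply_bcontfun (s k)"]
    unfolding Cauchy_def uniform_limit_sequentially_iff
    by (metis dist_fun_lt_imp_dist_val_lt)
  from uniform_limit_bcontfunE[OF this sequentially_bot]
  obtain x where x: "s \<longlonglongrightarrow> x"
    by metis
  have pt: "(\<lambda>k. apply_bcontfun (s k) n) \<longlonglongrightarrow> apply_bcontfun x n" for n
    using tendsto_uniform_limitI[OF tendsto_bcontfun_uniform_limit[OF x]] by simp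
  have mem: "apply_bcontfun x n \<in> V n" for n
    using s by (intro closed_sequentially[OF assms _ pt]) (auto simp: c_space_def)
  have "Cauchy (\<lambda>k. lim_map (s k))"
  proof (rule metric_CauchyI)
    fix e :: real assume "e > 0"
    then obtain M where "\<forall>m\<ge>M. \<forall>n\<ge>M. dist (s m) (s n) < e"
      using \<open>Cauchy s\<close> metric_CauchyD by blast
    then show "\<exists>M. \<forall>m\<ge>M. \<forall>n\<ge>M. dist (lim_map (s m)) (lim_map (s n)) < e"
      using s lim_map_diff unfolding dist_norm by (meson le_less_trans)
  qed
  then obtain l where l: "(\<lambda>k. lim_map (s k)) \<longlonglongrightarrow> l"
    using Cauchy_convergent unfolding convergent_def by (metis (no_types, lifting))
  have "apply_bcontfun x \<longlonglongrightarrow> l"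
  proof (rule swap_uniform_limit'[OF _ l tendsto_bcontfun_uniform_limit[OF x]])
    show "\<forall>\<^sub>F k in sequentially. apply_bcontfun (s k) \<longlonglongrightarrow> lim_map (s k)"
      using c_spaceD s by (intro always_eventually) blast
  qed auto
  then show "\<exists>l\<in>c_space V. s \<longlonglongrightarrow> l"
    using mem x unfolding c_space_def convergent_def by blast
qed

lemma banach_c0_space:
  fixes V :: "nat \<Rightarrow> 'a::banach set"
  assumes "banach_subspace (c_space V)"
  shows "banach_subspace (c0_space V)"
  unfolding banach_subspace_def
proof
  have sub: "subspace (c_space V)" and com: "complete (c_space V)"
    using assms unfolding banach_subspace_def by auto
  have "lim_map 0 = (0 :: 'a)"
    by (rule lim_mapI) simp
  then show "subspace (c0_space V)"
    using sub unfolding subspace_def c0_space_eq by (auto simp: c_space_linear)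
  show "complete (c0_space V)"
    unfolding complete_def
  proof (intro allI impI, elim conjE)
    fix s assume s: "\<forall>k. s k \<in> c0_space V" and "Cauchy s"
    then obtain x where x: "x \<in> c_space V" "s \<longlonglongrightarrow> x"
      using com unfolding complete_def c0_space_eq by blast
    have "norm (lim_map x) \<le> norm (x - s k)" for k
      using lim_map_diff[of x V "s k"] s x(1) by (simp add: c0_space_eq)
    moreover have "(\<lambda>k. norm (x - s k)) \<longlonglongrightarrow> 0"
      using tendsto_norm[OF tendsto_diff[OF tendsto_const[of x] x(2)]] by simp
    ultimately have "norm (lim_map x) \<le> 0"
      by (intro LIMSEQ_le_const) auto
    then show "\<exists>l\<in>c0_space V. s \<longlonglongrightarrow> l"
      using x by (auto simp: c0_space_eq)
  qed
qed

lemma ex_c_space_tendsto: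
  fixes V :: "nat \<Rightarrow> 'a::real_normed_vector set"
  assumes V: "\<And>n. subspace (V n)" "incseq V" and x: "x \<in> closure (\<Union>n. V n)"
  shows "\<exists>z\<in>c_space V. lim_map z = x"
proof -
  have ne: "V n \<noteq> {}" for n
    using V(1)[of n] subspace_0 by blast
  have "\<exists>y\<in>V n. dist x y < infdist x (V n) + inverse (real (Suc n))" for n
    using cInf_lessD[of "dist x ` V n" "infdist x (V n) + inverse (real (Suc n))"] ne[of n]
    by (auto simp: infdist_notempty)
  then obtain y where y: "\<And>n. y n \<in> V n"
    and yx: "\<And>n. dist x (y n) < infdist x (V n) + inverse (real (Suc n))"
    by metis
  have "y \<longlonglongrightarrow> x"
  proof (rule metric_LIMSEQ_I)
    fix e :: real assume "e > 0"
    then obtain N v where v: "v \<in> V N" "dist v x < e / 2"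
      using x unfolding closure_approachable by (metis UN_E half_gt_zero)
    obtain M where M: "inverse (real (Suc M)) < e / 2"
      using \<open>e > 0\<close> reals_Archimedean half_gt_zero by blast
    have "dist (y n) x < e" if "n \<ge> max N M" for n
    proof -
      have "v \<in> V n"
        using v(1) V(2) that by (meson incseqD max.boundedE subsetD)
      then have "infdist x (V n) < e / 2"
        using infdist_le[of v "V n" x] v(2) by (simp add: dist_commute)
      moreover have "inverse (real (Suc n)) \<le> inverse (real (Suc M))"
        using that by (intro le_imp_inverse_le) auto
      ultimately show ?thesis
        using yx[of n] M unfolding dist_commute[of "y n"] by linarith
    qed
    then show "\<exists>no. \<forall>n\<ge>no. dist (y n) x < e" by blast
  qed
  then have "y \<in> bcontfun"
    unfolding bcontfun_def using convergent_imp_bounded by auto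
  then obtain z where "y = apply_bcontfun z"
    by (rule bcontfunE)
  then show ?thesis
    using y \<open>y \<longlonglongrightarrow> x\<close> by (intro bexI[of _ z]) (auto simp: c_space_def convergent_def intro: lim_mapI)
qed

lemma short_exact_c_space:
  fixes X :: "'a::banach set"
  assumes X: "subspace X" "closed X" and V: "fd_exhaustion X V"
  shows "short_exact (\<lambda>x. x) lim_map (c0_space V) (c_space V) X"
proof -
  have fd: "finite_dim_subspace (V n)" for n
    using V unfolding fd_exhaustion_def by simp
  note sub = finite_dim_subspaceD(1)[OF fd] and cl = finite_dim_subspaceD(3)[OF fd]
  have V': "incseq V" "\<And>n. V n \<subseteq> X" "X \<subseteq> closure (\<Union>n. V n)"
    using V unfolding fd_exhaustion_def by (simp, fast, simp)
  have Z: "banach_subspace (c_space V)"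
    using subspace_c_space[of V] complete_c_space[of V] sub cl by (simp add: banach_subspace_def)
  have "lim_map z \<in> X" if "z \<in> c_space V" for z
    using that V'(2) by (intro closed_sequentially[OF X(2) _ c_spaceD[OF that]])
      (auto simp: c_space_def)
  moreover have "\<exists>z\<in>c_space V. lim_map z = x" if "x \<in> X" for x
    using ex_c_space_tendsto[OF sub V'(1)] V'(3) that by blast
  ultimately have img: "lim_map ` c_space V = X"
    by force
  have "bounded_linear_between (c_space V) X lim_map"
    unfolding bounded_linear_between_def
    using img by (auto simp: c_space_linear intro!: exI[of _ 1])
  moreover have "bounded_linear_between (c0_space V) (c_space V) (\<lambda>x. x)"
    unfolding bounded_linear_between_def by (auto simp: c0_space_eq intro!: exI[of _ 1])
  ultimately show ?thesis
    unfolding short_exact_def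
    using Z banach_c0_space[OF Z] X img
    by (auto simp: banach_subspace_def complete_eq_closed c0_space_eq)
qed

end

theory Submission
  imports Defs
begin

text \<open>
  A lifting is a sequence of operators in disguise: the coordinates of a lifting \<open>L\<close> are maps
  \<open>T n\<close> into \<open>E n\<close> which send \<open>X2\<close> into \<open>F n\<close>, have norm at most \<open>lam\<close>, and converge pointwise
  to the identity.  Conversely, every such sequence is the sequence of coordinates of a lifting,
  because the norm of a bounded sequence is the supremum of the norms of its terms.  So the theorem
  says that the approximation property is equivalent to the existence of such a sequence.

  Such a sequence yields the approximation property because pointwise convergence of uniformly
  bounded operators is uniform on compact sets (\<open>equibounded_convergence_on_compact\<close>).

  For the converse, the approximation property only provides finite-rank operators \<open>S\<close> with
  arbitrary ranges, and two things have to be repaired.  First, the range must be moved into the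
  paving.  Since a finite-dimensional space has bounded coordinate functionals, replacing a basis of
  the range by nearby vectors of some \<open>E n\<close> perturbs \<open>S\<close> by a small multiple of its norm.  If the
  basis starts with a basis of \<open>S ` X2\<close>, whose elements are approximated from \<open>F n\<close>, then \<open>X2\<close> is
  sent into \<open>F n\<close> (\<open>fd_subspace_into_paving\<close>).  The norm may grow by a factor \<open>1 + \<delta>\<close>, and
  dividing by this factor restores the bound \<open>lam\<close> exactly, at the cost of another small error
  (\<open>BAP_pair_into_paving\<close>).  Second, the stage \<open>n\<close> that is reached in this way is not under
  control.  But each degree of accuracy on a finite part of a countable dense set is available at
  all sufficiently late stages, and a diagonal choice (\<open>diagonal_choice\<close>) gives one operator for
  each stage so that each degree of accuracy is eventually met.
\<close>

section \<open>Finite-dimensional subspaces\<close>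

lemma finite_dim_subspace_extend_basis:
  fixes V W :: "'a::real_vector set"
  assumes "finite_dim_subspace V" "subspace W" "W \<subseteq> V"
  obtains C B where "C \<subseteq> B" "finite B" "independent B" "span C = W" "span B = V"
proof -
  obtain D where D: "finite D" "span D = V"
    using assms(1) unfolding finite_dim_subspace_def by blast
  obtain C where C: "C \<subseteq> W" "independent C" "W \<subseteq> span C"
    using maximal_independent_subset by blast
  obtain B where B: "C \<subseteq> B" "B \<subseteq> V" "independent B" "V \<subseteq> span B"
    using maximal_independent_subset_extend[of C V] C assms(3) by blast
  have "finite B"
    using independent_span_bound[OF D(1) B(3)] B(2) D(2) by blast
  moreover have "span C = W"
    using C assms(2) by (meson span_minimal subset_antisym)
  moreover have "span B = V"
    using B D(2) by (metis span_minimal subset_antisym subspace_span)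
  ultimately show thesis
    using that B by blast
qed

lemma finite_dim_subspace_subset:
  assumes "finite_dim_subspace V" "subspace W" "W \<subseteq> V"
  shows "finite_dim_subspace W"
proof -
  obtain C B where "C \<subseteq> B" "finite B" "span C = W"
    using finite_dim_subspace_extend_basis[OF assms] .
  then show ?thesis
    unfolding finite_dim_subspace_def using finite_subset by blast
qed

text \<open>The span of the other basis vectors is closed, so \<open>b\<close> has a positive distance \<open>d\<close> from it;
  a vector with \<open>b\<close>-coordinate \<open>k\<close> then has norm at least \<open>\<bar>k\<bar> * d\<close>.\<close>

lemma coordinate_functional_bounded:
  fixes B :: "'a::real_normed_vector set"
  assumes "finite B" "independent B" "b \<in> B"
  obtains d where "d > 0" "\<And>y. y \<in> span B \<Longrightarrow> \<bar>representation B y b\<bar> * d \<le> norm y"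
proof -
  let ?V = "span (B - {b})"
  have "finite_dim_subspace ?V"
    using assms(1) unfolding finite_dim_subspace_def by blast
  then have "closed ?V"
    by (rule finite_dim_subspaceD)
  moreover have "b \<notin> ?V"
    using assms(2,3) dependent_def by blast
  ultimately obtain d where d: "d > 0" "ball b d \<subseteq> - ?V"
    by (metis ComplI open_Compl openE)
  have "\<bar>representation B y b\<bar> * d \<le> norm y" if y: "y \<in> span B" for y
  proof (cases "representation B y b = 0")
    case False
    define k where "k = representation B y b"
    define v where "v = (\<Sum>c\<in>B - {b}. representation B y c *\<^sub>R c)"
    have "y = (\<Sum>c\<in>B. representation B y c *\<^sub>R c)"
      using sum_representation_eq[OF assms(2) y assms(1) order_refl] by simp
    then have yv: "y = k *\<^sub>R b + v"
      using assms(1,3) by (simp add: sum.remove k_def v_def)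
    have "v \<in> ?V"
      unfolding v_def by (intro span_sum span_scale span_base)
    then have "- (1 / k) *\<^sub>R v \<in> ?V"
      by (rule span_scale)
    then have "- (1 / k) *\<^sub>R v \<notin> ball b d"
      using d(2) by blast
    then have "d \<le> norm (b + (1 / k) *\<^sub>R v)"
      by (simp add: dist_norm)
    then have "\<bar>k\<bar> * d \<le> norm (k *\<^sub>R (b + (1 / k) *\<^sub>R v))"
      by (simp add: mult_left_mono)
    also have "k *\<^sub>R (b + (1 / k) *\<^sub>R v) = y"
    proof -
      have "k \<noteq> 0"
        using False by (simp add: k_def)
      then show ?thesis
        by (simp add: yv scaleR_add_right)
    qed
    finally show ?thesis
      by (simp add: k_def)
  qed simp
  with d(1) show thesis
    using that by blast
qed

section \<open>Moving finite-rank operators into a paving\<close>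

lemma pavingD:
  assumes "paving X1 X2 E F"
  shows "incseq E" "incseq F" "subspace (E n)" "subspace (F n)"
  using assms unfolding paving_def fd_exhaustion_def by (simp_all add: finite_dim_subspaceD(1))

lemma finite_choice_in_incseq_Union:
  fixes V :: "nat \<Rightarrow> 'a set"
  assumes "finite B" "incseq V" "\<And>b. b \<in> B \<Longrightarrow> g b \<in> (\<Union>n. V n)"
  obtains N where "\<And>b. b \<in> B \<Longrightarrow> g b \<in> V N"
proof -
  have "\<forall>b\<in>B. \<exists>n. g b \<in> V n"
    using assms(3) by blast
  then obtain m where m: "\<And>b. b \<in> B \<Longrightarrow> g b \<in> V (m b)"
    by metis
  have "g b \<in> V (Max (m ` B))" if "b \<in> B" for b
    using m[OF that] incseqD[OF assms(2), of "m b" "Max (m ` B)"] assms(1) that by auto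
  then show thesis
    using that by blast
qed

text \<open>The map \<open>A\<close> replaces each vector of a basis of \<open>G\<close> adapted to \<open>G2\<close> by a nearby vector of the
  paving; how near is dictated by the bounds of the coordinate functionals.\<close>

lemma fd_subspace_into_paving:
  fixes G G2 :: "'a::real_normed_vector set"
  assumes pav: "paving X1 X2 E F"
    and G: "finite_dim_subspace G" "G \<subseteq> X1"
    and G2: "subspace G2" "G2 \<subseteq> G" "G2 \<subseteq> X2"
    and "\<delta> > 0"
  obtains A N where "linear A" "A ` G \<subseteq> E N" "A ` G2 \<subseteq> F N"
    "\<And>y. y \<in> G \<Longrightarrow> norm (A y - y) \<le> \<delta> * norm y"
proof -
  note E = pavingD(1,3)[OF pav] and F = pavingD(2,4)[OF pav]
  have X1: "X1 \<subseteq> closure (\<Union>n. E n)" and X2: "X2 \<subseteq> closure (\<Union>n. F n)"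
    and FE: "\<And>n. F n \<subseteq> E n"
    using pav unfolding paving_def fd_exhaustion_def by simp_all
  obtain C B where B: "C \<subseteq> B" "finite B" "independent B" "span C = G2" "span B = G"
    using finite_dim_subspace_extend_basis[OF G(1) G2(1,2)] .
  have "\<forall>b\<in>B. \<exists>d>0. \<forall>y\<in>G. \<bar>representation B y b\<bar> * d \<le> norm y"
    using coordinate_functional_bounded[OF B(2,3)] B(5) by metis
  then obtain d where d: "\<And>b. b \<in> B \<Longrightarrow> d b > 0"
    "\<And>b y. b \<in> B \<Longrightarrow> y \<in> G \<Longrightarrow> \<bar>representation B y b\<bar> * d b \<le> norm y"
    by metis
  \<comment> \<open>The errors at the \<open>card B\<close> basis vectors add up; the extra 1 covers the empty basis.\<close>
  define \<eta> where "\<eta> b = \<delta> * d b / (real (card B) + 1)" for b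
  have \<eta>: "\<eta> b > 0" if "b \<in> B" for b
    using d(1)[OF that] \<open>\<delta> > 0\<close> by (simp add: \<eta>_def)
  have "\<exists>v\<in>(if b \<in> C then \<Union>n. F n else \<Union>n. E n). dist v b < \<eta> b" if b: "b \<in> B" for b
  proof (cases "b \<in> C")
    case True
    then have "b \<in> closure (\<Union>n. F n)"
      using B(4) G2(3) X2 span_base by blast
    then show ?thesis
      using True \<eta>[OF b] by (simp only: closure_approachable if_True)
  next
    case False
    have "b \<in> closure (\<Union>n. E n)"
      using b B(5) G(2) X1 span_base by blast
    then show ?thesis
      using False \<eta>[OF b] by (simp only: closure_approachable if_False)
  qed
  then obtain g where g: "\<And>b. b \<in> B \<Longrightarrow> g b \<in> (if b \<in> C then \<Union>n. F n else \<Union>n. E n)"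
    and gd: "\<And>b. b \<in> B \<Longrightarrow> dist (g b) b < \<eta> b"
    by metis
  have "finite C"
    using B(1,2) finite_subset by blast
  moreover have "g b \<in> (\<Union>n. F n)" if "b \<in> C" for b
    using g[of b] that B(1) by auto
  ultimately obtain N1 where N1: "\<And>b. b \<in> C \<Longrightarrow> g b \<in> F N1"
    using finite_choice_in_incseq_Union[OF _ F(1)] by metis
  have "g b \<in> (\<Union>n. E n)" if "b \<in> B" for b
    using g[OF that] FE by (fastforce split: if_splits)
  then obtain N2 where N2: "\<And>b. b \<in> B \<Longrightarrow> g b \<in> E N2"
    using finite_choice_in_incseq_Union[OF B(2) E(1)] by metis
  define N where "N = max N1 N2"
  have gF: "g ` C \<subseteq> F N" and gE: "g ` B \<subseteq> E N"
    using N1 N2 incseqD[OF F(1), of N1 N] incseqD[OF E(1), of N2 N] unfolding N_def by auto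
  define A where "A = construct B g"
  have lin: "linear A"
    unfolding A_def using B(3) by (rule linear_construct)
  have Ab: "A b = g b" if "b \<in> B" for b
    unfolding A_def using B(3) that by (rule construct_basis)
  have AC: "A ` C = g ` C" and AB: "A ` B = g ` B"
    using Ab B(1) by (auto simp: image_iff subset_iff)
  have "A ` G \<subseteq> E N"
    using span_minimal[OF gE E(2)] linear_span_image[OF lin, of B] AB B(5) by simp
  moreover have "A ` G2 \<subseteq> F N"
    using span_minimal[OF gF F(2)] linear_span_image[OF lin, of C] AC B(4) by simp
  moreover have "norm (A y - y) \<le> \<delta> * norm y" if y: "y \<in> G" for y
  proof -
    let ?r = "representation B y"
    have eq: "(\<Sum>b\<in>B. ?r b *\<^sub>R b) = y"
      using sum_representation_eq[OF B(3) _ B(2) order_refl] y B(5) by simp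
    have "A y = (\<Sum>b\<in>B. ?r b *\<^sub>R A b)"
      by (subst eq[symmetric]) (simp add: linear_sum[OF lin] linear_scale[OF lin])
    also have "\<dots> = (\<Sum>b\<in>B. ?r b *\<^sub>R g b)"
      by (simp add: Ab)
    finally have "A y - y = (\<Sum>b\<in>B. ?r b *\<^sub>R (g b - b))"
      using eq by (simp add: scaleR_diff_right sum_subtractf)
    then have "norm (A y - y) \<le> (\<Sum>b\<in>B. norm (?r b *\<^sub>R (g b - b)))"
      by (simp only: norm_sum)
    also have "\<dots> \<le> (\<Sum>b\<in>B. \<delta> * norm y / (real (card B) + 1))"
    proof (rule sum_mono)
      fix b assume b: "b \<in> B"
      have "norm (?r b *\<^sub>R (g b - b)) \<le> \<bar>?r b\<bar> * \<eta> b"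
        using gd[OF b] by (simp add: dist_norm mult_left_mono)
      also have "\<dots> = (\<bar>?r b\<bar> * d b) * (\<delta> / (real (card B) + 1))"
        by (simp add: \<eta>_def)
      also have "\<dots> \<le> norm y * (\<delta> / (real (card B) + 1))"
        using d(2)[OF b y] \<open>\<delta> > 0\<close> by (intro mult_right_mono) auto
      finally show "norm (?r b *\<^sub>R (g b - b)) \<le> \<delta> * norm y / (real (card B) + 1)"
        by (simp add: mult.commute)
    qed
    also have "\<dots> = (real (card B) / (real (card B) + 1)) * (\<delta> * norm y)"
      by simp
    also have "\<dots> \<le> 1 * (\<delta> * norm y)"
      using \<open>\<delta> > 0\<close> by (intro mult_right_mono) auto
    finally show ?thesis by simp
  qed
  ultimately show thesis
    using that lin by blast
qed

lemma BAP_pair_into_paving: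
  fixes X2 :: "'a::real_normed_vector set"
  assumes bap: "has_BAP_pair lam X2" and X2: "subspace X2"
    and pav: "paving UNIV X2 E F"
    and "0 \<le> lam" "finite K" "\<epsilon> > 0"
  obtains T N where "bounded_linear T" "onorm T \<le> lam" "range T \<subseteq> E N" "T ` X2 \<subseteq> F N"
    "\<And>x. x \<in> K \<Longrightarrow> norm (T x - x) \<le> \<epsilon>"
proof -
  obtain S where S: "bounded_linear S" "finite_dim_subspace (range S)" "onorm S \<le> lam"
    "\<And>x. x \<in> K \<Longrightarrow> norm (S x - x) \<le> \<epsilon> / 2" "S ` X2 \<subseteq> X2"
    using bap \<open>\<epsilon> > 0\<close> finite_imp_compact[OF \<open>finite K\<close>] unfolding has_BAP_pair_def
    by (metis half_gt_zero)
  have nS: "norm (S x) \<le> lam * norm x" for x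
    using onorm[OF S(1), of x] mult_right_mono[OF S(3), of "norm x"] by force
  obtain M where M: "M > 0" "\<And>x. x \<in> K \<Longrightarrow> norm x \<le> M"
    using finite_imp_bounded[OF \<open>finite K\<close>] unfolding bounded_pos by blast
  define c where "c = (lam + 1) * M"
  have "c > 0"
    using \<open>0 \<le> lam\<close> M(1) by (simp add: c_def)
  define \<delta> where "\<delta> = \<epsilon> / (2 * c)"
  have \<delta>: "\<delta> > 0"
    using \<open>\<epsilon> > 0\<close> \<open>c > 0\<close> by (simp add: \<delta>_def)
  have linS: "linear S"
    using S(1) by (rule bounded_linear.linear)
  have "subspace (S ` X2)"
    using linS X2 by (rule linear_subspace_image)
  then obtain A N where A: "linear A" "A ` range S \<subseteq> E N" "A ` S ` X2 \<subseteq> F N"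
    "\<And>y. y \<in> range S \<Longrightarrow> norm (A y - y) \<le> \<delta> * norm y"
    using fd_subspace_into_paving[OF pav S(2) subset_UNIV _ _ S(5) \<delta>] by blast
  \<comment> \<open>Dividing by \<open>1 + \<delta>\<close> brings the norm, at most \<open>(1 + \<delta>) * lam\<close>, back to \<open>lam\<close>.\<close>
  define T where "T x = (1 / (1 + \<delta>)) *\<^sub>R A (S x)" for x
  have AS: "norm (A (S x) - S x) \<le> \<delta> * norm (S x)" for x
    using A(4) by simp
  have nT: "norm (T x) \<le> lam * norm x" for x
  proof -
    have "norm (A (S x)) \<le> (1 + \<delta>) * norm (S x)"
      using AS[of x] norm_triangle_sub[of "A (S x)" "S x"] by (simp add: algebra_simps)
    then have "norm (T x) \<le> norm (S x)"
      using \<delta> by (simp add: T_def divide_simps mult.commute)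
    then show ?thesis
      using nS[of x] by linarith
  qed
  have "linear T"
    unfolding T_def using linear_compose[OF linS A(1)]
    by (intro linear_compose_scale_right) (simp add: o_def)
  then have "bounded_linear T"
    using nT by (intro bounded_linear.intro bounded_linear_axioms.intro)
      (auto simp: mult.commute intro!: exI[of _ lam])
  moreover have "onorm T \<le> lam"
    using nT \<open>0 \<le> lam\<close> by (intro onorm_bound)
  moreover have "range T \<subseteq> E N" "T ` X2 \<subseteq> F N"
    using A(2,3) pavingD(3,4)[OF pav] by (auto simp: T_def intro!: subspace_scale)
  moreover have "norm (T x - x) \<le> \<epsilon>" if x: "x \<in> K" for x
  proof -
    have "(1 + \<delta>) *\<^sub>R (T x - x) = (A (S x) - S x) + (S x - x) - \<delta> *\<^sub>R x"
      using \<delta> by (simp add: T_def algebra_simps)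
    then have "(1 + \<delta>) * norm (T x - x) = norm ((A (S x) - S x) + (S x - x) - \<delta> *\<^sub>R x)"
      using \<delta> by (metis abs_of_pos add_pos_pos norm_scaleR zero_less_one)
    also have "\<dots> \<le> norm (A (S x) - S x) + norm (S x - x) + \<delta> * norm x"
      using norm_triangle_ineq4[of "(A (S x) - S x) + (S x - x)" "\<delta> *\<^sub>R x"]
        norm_triangle_ineq[of "A (S x) - S x" "S x - x"] \<delta> by simp
    also have "\<dots> \<le> \<delta> * (lam * M) + \<epsilon> / 2 + \<delta> * M"
    proof -
      have "norm (S x) \<le> lam * M"
        using nS[of x] mult_left_mono[OF M(2)[OF x] \<open>0 \<le> lam\<close>] by linarith
      then have "\<delta> * norm (S x) \<le> \<delta> * (lam * M)"
        using \<delta> by simp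
      moreover have "\<delta> * norm x \<le> \<delta> * M"
        using \<delta> M(2)[OF x] by simp
      ultimately show ?thesis
        using AS[of x] S(4)[OF x] by linarith
    qed
    also have "\<dots> = \<delta> * c + \<epsilon> / 2"
      by (simp add: c_def algebra_simps)
    also have "\<delta> * c = \<epsilon> / 2"
      using \<open>c > 0\<close> by (simp add: \<delta>_def)
    finally have "(1 + \<delta>) * norm (T x - x) \<le> \<epsilon>"
      by simp
    moreover have "norm (T x - x) \<le> (1 + \<delta>) * norm (T x - x)"
      using \<delta> by (simp add: mult_le_cancel_right1)
    ultimately show ?thesis
      by linarith
  qed
  ultimately show thesis
    using that by blast
qed

section \<open>Pointwise convergence of equibounded operators\<close>

text \<open>This lets points of a dense set, or of a finite net, control the approximation error at all
  points near them.\<close>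

lemma norm_error_transfer:
  assumes lin: "linear T" and bd: "\<And>x. norm (T x) \<le> lam * norm x"
  shows "norm (T x - x) \<le> (lam + 1) * norm (y - x) + norm (T y - y)"
proof -
  have "T x - x = T (x - y) + (T y - y) + (y - x)"
    by (simp add: linear_diff[OF lin])
  then have "norm (T x - x) \<le> norm (T (x - y)) + norm (T y - y) + norm (y - x)"
    using norm_triangle_ineq[of "T (x - y) + (T y - y)" "y - x"]
      norm_triangle_ineq[of "T (x - y)" "T y - y"] by simp
  also have "norm (T (x - y)) \<le> lam * norm (y - x)"
    using bd[of "x - y"] by (simp add: norm_minus_commute)
  finally show ?thesis
    by (simp add: algebra_simps)
qed

lemma equibounded_convergence_dense:
  fixes T :: "nat \<Rightarrow> 'a::real_normed_vector \<Rightarrow> 'a"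
  assumes lin: "\<And>n. linear (T n)" and bd: "\<And>n x. norm (T n x) \<le> lam * norm x" and "0 \<le> lam"
    and D: "closure D = UNIV" "\<And>x. x \<in> D \<Longrightarrow> (\<lambda>n. T n x) \<longlonglongrightarrow> x"
  shows "(\<lambda>n. T n x) \<longlonglongrightarrow> x"
proof (rule metric_LIMSEQ_I)
  fix e :: real assume e: "e > 0"
  obtain \<eta> where \<eta>: "\<eta> > 0" "(lam + 1) * \<eta> = e / 2"
  proof (rule that[of "(e / 2) / (lam + 1)"])
    have "lam + 1 > 0"
      using \<open>0 \<le> lam\<close> by simp
    then show "e / 2 / (lam + 1) > 0" "(lam + 1) * (e / 2 / (lam + 1)) = e / 2"
      using \<open>e > 0\<close> by (simp, metis less_irrefl nonzero_mult_div_cancel_left times_divide_eq_right)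
  qed
  then obtain y where y: "y \<in> D" "dist y x < \<eta>"
    using D(1) closure_approachable[of x D] by auto
  obtain N where N: "\<And>n. n \<ge> N \<Longrightarrow> dist (T n y) y < e / 2"
    using metric_LIMSEQ_D[OF D(2)[OF y(1)], of "e / 2"] e by auto
  have "dist (T n x) x < e" if "n \<ge> N" for n
  proof -
    have "norm (T n x - x) \<le> (lam + 1) * norm (y - x) + norm (T n y - y)"
      using lin bd by (rule norm_error_transfer)
    also have "(lam + 1) * norm (y - x) \<le> (lam + 1) * \<eta>"
      using y(2) \<open>0 \<le> lam\<close> by (intro mult_left_mono) (auto simp: dist_norm)
    also have "(lam + 1) * \<eta> = e / 2"
      by (rule \<eta>(2))
    finally show ?thesis
      using N[OF that] by (simp add: dist_norm)
  qed
  then show "\<exists>N. \<forall>n\<ge>N. dist (T n x) x < e"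
    by blast
qed

lemma equibounded_convergence_on_compact:
  fixes T :: "nat \<Rightarrow> 'a::real_normed_vector \<Rightarrow> 'a"
  assumes lin: "\<And>n. linear (T n)" and bd: "\<And>n x. norm (T n x) \<le> lam * norm x" and "0 \<le> lam"
    and conv: "\<And>x. (\<lambda>n. T n x) \<longlonglongrightarrow> x" and "compact K" "e > 0"
  shows "\<exists>n. \<forall>x\<in>K. norm (T n x - x) \<le> e"
proof -
  obtain \<eta> where \<eta>: "\<eta> > 0" "(lam + 1) * \<eta> = e / 2"
  proof (rule that[of "(e / 2) / (lam + 1)"])
    have "lam + 1 > 0"
      using \<open>0 \<le> lam\<close> by simp
    then show "e / 2 / (lam + 1) > 0" "(lam + 1) * (e / 2 / (lam + 1)) = e / 2"
      using \<open>e > 0\<close> by (simp, metis less_irrefl nonzero_mult_div_cancel_left times_divide_eq_right)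
  qed
  then obtain Q where Q: "finite Q" "K \<subseteq> (\<Union>y\<in>Q. ball y \<eta>)"
    using \<open>compact K\<close> unfolding compact_eq_totally_bounded by blast
  have "\<forall>\<^sub>F n in sequentially. dist (T n y) y < e / 2" for y
    using conv by (rule tendstoD) (simp add: \<open>e > 0\<close>)
  then have "\<forall>\<^sub>F n in sequentially. \<forall>y\<in>Q. dist (T n y) y < e / 2"
    by (intro eventually_ball_finite Q(1)) simp
  then obtain n where n: "\<And>y. y \<in> Q \<Longrightarrow> dist (T n y) y < e / 2"
    using eventually_happens'[OF sequentially_bot] by blast
  have "norm (T n x - x) \<le> e" if x: "x \<in> K" for x
  proof -
    obtain y where y: "y \<in> Q" "dist y x < \<eta>"
      using Q(2) x by auto
    have "norm (T n x - x) \<le> (lam + 1) * norm (y - x) + norm (T n y - y)"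
      using lin bd by (rule norm_error_transfer)
    also have "(lam + 1) * norm (y - x) \<le> (lam + 1) * \<eta>"
      using y(2) \<open>0 \<le> lam\<close> by (intro mult_left_mono) (auto simp: dist_norm)
    also have "(lam + 1) * \<eta> = e / 2"
      by (rule \<eta>(2))
    finally show ?thesis
      using n[OF y(1)] by (simp add: dist_norm)
  qed
  then show ?thesis
    by blast
qed

section \<open>From the approximation property to a sequence of operators\<close>

text \<open>At stage \<open>n\<close>, take a witness for the best degree \<open>k \<le> n\<close> that is available there.  The bound
  \<open>k \<le> n\<close> is needed for a best degree to exist.\<close>

lemma diagonal_choice:
  fixes P :: "nat \<Rightarrow> nat \<Rightarrow> 'b \<Rightarrow> bool"
  assumes ev: "\<And>k. \<forall>\<^sub>F n in sequentially. \<exists>T. P k n T"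
    and zero: "\<And>n. \<exists>T. P 0 n T"
    and mono: "\<And>j k n T. P k n T \<Longrightarrow> j \<le> k \<Longrightarrow> P j n T"
  shows "\<exists>T. (\<forall>n. P 0 n (T n)) \<and> (\<forall>k. \<forall>\<^sub>F n in sequentially. P k n (T n))"
proof -
  define J where "J n = {k. k \<le> n \<and> (\<exists>T. P k n T)}" for n
  have J: "finite (J n)" "0 \<in> J n" for n
    using zero by (auto simp: J_def)
  then have "Max (J n) \<in> J n" for n
    by (intro Max_in) auto
  then have "\<forall>n. \<exists>T. P (Max (J n)) n T"
    by (simp add: J_def)
  then obtain T where T: "\<And>n. P (Max (J n)) n (T n)"
    by metis
  have "P 0 n (T n)" for n
    using mono[OF T] by blast
  moreover have "\<forall>\<^sub>F n in sequentially. P k n (T n)" for k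
    using ev[of k] eventually_ge_at_top[of k]
  proof eventually_elim
    case (elim n)
    then have "k \<le> Max (J n)"
      using J(1) by (intro Max_ge) (auto simp: J_def)
    then show ?case
      by (rule mono[OF T])
  qed
  ultimately show ?thesis
    by blast
qed

lemma BAP_pair_imp_approximating_sequence:
  fixes X2 :: "'a::real_normed_vector set"
  assumes sep: "separable_space (euclidean :: 'a topology)"
    and bap: "has_BAP_pair lam X2" and X2: "subspace X2"
    and pav: "paving UNIV X2 E F" and "0 \<le> lam"
  obtains T where "\<And>n. bounded_linear (T n)" "\<And>n. onorm (T n) \<le> lam"
    "\<And>n. range (T n) \<subseteq> E n" "\<And>n. T n ` X2 \<subseteq> F n" "\<And>x. (\<lambda>n. T n x) \<longlonglongrightarrow> x"
proof -
  obtain D :: "'a set" where D: "countable D" "closure D = UNIV"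
    using sep unfolding separable_space_def by auto
  then have "D \<noteq> {}"
    by auto
  then have range_D: "range (from_nat_into D) = D"
    using D(1) by (rule range_from_nat_into)
  define x where "x = from_nat_into D"
  \<comment> \<open>Degree \<open>k\<close> asks for accuracy \<open>1 / (k + 1)\<close> at the first \<open>k\<close> points of the dense set.
    Degree 0 asks for nothing at any point, so the zero operator has it at every stage.\<close>
  define P where "P k n T \<longleftrightarrow> bounded_linear T \<and> onorm T \<le> lam \<and> range T \<subseteq> E n \<and> T ` X2 \<subseteq> F n \<and>
    (\<forall>i<k. norm (T (x i) - x i) \<le> inverse (real (Suc k)))" for k n T
  note inc = pavingD(1,2)[OF pav] and sub = pavingD(3,4)[OF pav]
  have ev: "\<forall>\<^sub>F n in sequentially. \<exists>T. P k n T" for k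
  proof -
    obtain T N where T: "bounded_linear T" "onorm T \<le> lam" "range T \<subseteq> E N" "T ` X2 \<subseteq> F N"
      "\<And>y. y \<in> x ` {..<k} \<Longrightarrow> norm (T y - y) \<le> inverse (real (Suc k))"
      using BAP_pair_into_paving[OF bap X2 pav \<open>0 \<le> lam\<close>, of "x ` {..<k}" "inverse (real (Suc k))"]
      by auto
    have "P k n T" if "n \<ge> N" for n
      using T incseqD[OF inc(1) that] incseqD[OF inc(2) that] unfolding P_def by blast
    then show ?thesis
      unfolding eventually_sequentially by blast
  qed
  have zero: "\<exists>T. P 0 n T" for n
    using sub \<open>0 \<le> lam\<close>
    by (intro exI[of _ "\<lambda>_. 0"]) (auto simp: P_def onorm_zero subspace_0)
  have mono: "P j n T" if "P k n T" "j \<le> k" for j k n T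
  proof -
    have "inverse (real (Suc k)) \<le> inverse (real (Suc j))"
      using that(2) by (intro le_imp_inverse_le) auto
    then show ?thesis
      using that unfolding P_def by (meson less_le_trans order_trans)
  qed
  have "\<exists>T. (\<forall>n. P 0 n (T n)) \<and> (\<forall>k. \<forall>\<^sub>F n in sequentially. P k n (T n))"
  proof (rule diagonal_choice)
  qed (fact ev zero mono)+
  then obtain T where T: "\<And>n. P 0 n (T n)" "\<And>k. \<forall>\<^sub>F n in sequentially. P k n (T n)"
    by blast
  have bl: "bounded_linear (T n)" and nT: "onorm (T n) \<le> lam" for n
    using T(1)[of n] unfolding P_def by blast+
  have dense: "(\<lambda>n. T n y) \<longlonglongrightarrow> y" if y: "y \<in> D" for y
  proof -
    obtain i where i: "y = x i"
      using y range_D unfolding x_def by (metis imageE)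
    show ?thesis
    proof (rule tendstoI)
      fix e :: real assume "e > 0"
      then obtain m where m: "inverse (real (Suc m)) < e"
        using reals_Archimedean by blast
      define k where "k = max m (Suc i)"
      have "inverse (real (Suc k)) \<le> inverse (real (Suc m))"
        by (intro le_imp_inverse_le) (auto simp: k_def)
      then have k: "inverse (real (Suc k)) < e" "i < k"
        using m by (linarith, simp add: k_def)
      show "\<forall>\<^sub>F n in sequentially. dist (T n y) y < e"
        using T(2)[of k]
      proof eventually_elim
        case (elim n)
        then have "norm (T n (x i) - x i) \<le> inverse (real (Suc k))"
          using k(2) unfolding P_def by blast
        then show ?case
          using k(1) by (simp add: dist_norm i)
      qed
    qed
  qed
  have "norm (T n y) \<le> lam * norm y" for n y
    using onorm[OF bl, of n y] mult_right_mono[OF nT, of "norm y" n] by force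
  then have "(\<lambda>n. T n y) \<longlonglongrightarrow> y" for y
    using equibounded_convergence_dense[of T lam D] bl \<open>0 \<le> lam\<close> D(2) dense
    by (simp add: bounded_linear.linear)
  then show thesis
    using that[of T] T(1) unfolding P_def by blast
qed

section \<open>Liftings as sequences of operators\<close>

lemma lifting_of_approximating_sequence:
  fixes T :: "nat \<Rightarrow> 'a::real_normed_vector \<Rightarrow> 'a"
  assumes bl: "\<And>n. bounded_linear (T n)" and nT: "\<And>n. onorm (T n) \<le> lam" and "0 \<le> lam"
    and E: "\<And>n. range (T n) \<subseteq> E n" and F: "\<And>n. T n ` X2 \<subseteq> F n"
    and conv: "\<And>x. (\<lambda>n. T n x) \<longlonglongrightarrow> x"
  obtains L :: "'a \<Rightarrow> nat \<Rightarrow>\<^sub>C 'a" where "bounded_linear L" "range L \<subseteq> c_space E"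
    "\<And>x. lim_map (L x) = x" "L ` X2 \<subseteq> c_space F" "onorm L \<le> lam"
proof -
  have "(\<lambda>n. T n x) \<in> bcontfun" for x
    unfolding bcontfun_def using conv[of x] convergent_imp_bounded by auto
  then have "\<forall>x. \<exists>f. apply_bcontfun f = (\<lambda>n. T n x)"
    by (metis bcontfunE)
  then obtain L where L: "\<And>x. apply_bcontfun (L x) = (\<lambda>n. T n x)"
    by metis
  have "norm (T n x) \<le> lam * norm x" for n x
    using onorm[OF bl, of n x] mult_right_mono[OF nT, of "norm x" n] by force
  then have nL: "norm (L x) \<le> lam * norm x" for x
    by (intro norm_bound) (simp add: L)
  have "L (x + y) = L x + L y" "L (r *\<^sub>R x) = r *\<^sub>R L x" for x y r
    using bl by (auto intro!: bcontfun_eqI simp: L linear_add linear_scale bounded_linear.linear)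
  then have "bounded_linear L"
    using nL by (intro bounded_linear_intro[of L lam]) (auto simp: mult.commute)
  moreover have "onorm L \<le> lam"
    using nL \<open>0 \<le> lam\<close> by (intro onorm_bound)
  moreover have "convergent (apply_bcontfun (L x))" for x
    using conv[of x] unfolding L convergent_def by blast
  then have "range L \<subseteq> c_space E" "L ` X2 \<subseteq> c_space F"
    using E F by (simp_all add: c_space_def L image_subset_iff)
  moreover have "lim_map (L x) = x" for x
    using conv by (intro lim_mapI) (simp add: L)
  ultimately show thesis
    using that by blast
qed

lemma BAP_pair_of_lifting:
  fixes L :: "'a::real_normed_vector \<Rightarrow> nat \<Rightarrow>\<^sub>C 'a"
  assumes pav: "paving UNIV X2 E F" and "0 \<le> lam"
    and L: "bounded_linear L" "range L \<subseteq> c_space E" "\<And>x. lim_map (L x) = x"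
      "L ` X2 \<subseteq> c_space F" "onorm L \<le> lam"
  shows "has_BAP_pair lam X2"
  unfolding has_BAP_pair_def
proof (intro allI impI)
  fix e :: real and K :: "'a set" assume "e > 0" "compact K"
  define T where "T n x = apply_bcontfun (L x) n" for n x
  have linL: "linear L"
    using L(1) by (rule bounded_linear.linear)
  have lin: "linear (T n)" for n
    by (rule linearI) (simp_all add: T_def linear_add[OF linL] linear_scale[OF linL])
  have nT: "norm (T n x) \<le> lam * norm x" for n x
    using norm_bounded[of "L x" n] onorm[OF L(1), of x] mult_right_mono[OF L(5), of "norm x"]
    unfolding T_def by force
  have conv: "(\<lambda>n. T n x) \<longlonglongrightarrow> x" for x
    using c_spaceD[of "L x" E] L(2,3) by (auto simp: T_def)
  have "\<exists>n. \<forall>x\<in>K. norm (T n x - x) \<le> e"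
    using lin nT \<open>0 \<le> lam\<close> conv \<open>compact K\<close> \<open>e > 0\<close> by (rule equibounded_convergence_on_compact)
  then obtain n where n: "\<forall>x\<in>K. norm (T n x - x) \<le> e" ..
  have "bounded_linear (T n)"
    using lin nT by (intro bounded_linear.intro bounded_linear_axioms.intro)
      (auto simp: mult.commute intro!: exI[of _ lam])
  moreover have "finite_dim_subspace (range (T n))"
  proof (rule finite_dim_subspace_subset)
    show "finite_dim_subspace (E n)"
      using pav by (simp add: paving_def fd_exhaustion_def)
    show "subspace (range (T n))"
      using lin by (intro linear_subspace_image) auto
    show "range (T n) \<subseteq> E n"
      using L(2) by (auto simp: T_def c_space_def)
  qed
  moreover have "onorm (T n) \<le> lam"
    using nT \<open>0 \<le> lam\<close> by (intro onorm_bound)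
  moreover have "T n ` X2 \<subseteq> X2"
  proof -
    have "T n ` X2 \<subseteq> F n"
      using L(4) by (auto simp: T_def c_space_def)
    also have "F n \<subseteq> X2"
      using pav by (simp add: paving_def fd_exhaustion_def UN_subset_iff)
    finally show ?thesis .
  qed
  ultimately show "\<exists>S. bounded_linear S \<and> finite_dim_subspace (range S) \<and> onorm S \<le> lam \<and>
      (\<forall>x\<in>K. norm (S x - x) \<le> e) \<and> S ` X2 \<subseteq> X2"
    using n by blast
qed

theorem theorem5p7:
  fixes X2 :: "'a::banach set" and E F :: "nat \<Rightarrow> 'a set" and lam :: real
  assumes "separable_space (euclidean :: 'a topology)"
    and "subspace X2" and "closed X2"
    and "paving UNIV X2 E F"
    and "1 \<le> lam"
  shows "has_BAP_pair lam X2 \<longleftrightarrow>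
    admits_simultaneous_lifting lam (\<lambda>x. x) lim_map
      (c0_space E) (c_space E) (c0_space F) (c_space F) X2"
proof -
  have lam: "0 \<le> lam"
    using assms(5) by simp
  show ?thesis
  proof
    assume "has_BAP_pair lam X2"
    then obtain T where "\<And>n. bounded_linear (T n)" "\<And>n. onorm (T n) \<le> lam"
      "\<And>n. range (T n) \<subseteq> E n" "\<And>n. T n ` X2 \<subseteq> F n" "\<And>x. (\<lambda>n. T n x) \<longlonglongrightarrow> x"
      using BAP_pair_imp_approximating_sequence[OF assms(1) _ assms(2,4) lam] by blast
    then obtain L :: "'a \<Rightarrow> nat \<Rightarrow>\<^sub>C 'a" where "bounded_linear L" "range L \<subseteq> c_space E"
      "\<And>x. lim_map (L x) = x" "L ` X2 \<subseteq> c_space F" "onorm L \<le> lam"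
      using lifting_of_approximating_sequence[of T lam E X2 F] lam by blast
    moreover have "short_exact (\<lambda>x. x) lim_map (c0_space E) (c_space E) UNIV"
      "short_exact (\<lambda>x. x) lim_map (c0_space F) (c_space F) X2"
      using assms(2-4) unfolding paving_def by (auto intro!: short_exact_c_space)
    moreover have "c0_space F \<subseteq> c0_space E" "c_space F \<subseteq> c_space E"
      using assms(4) unfolding paving_def c0_space_def c_space_def by blast+
    ultimately show "admits_simultaneous_lifting lam (\<lambda>x. x) lim_map
        (c0_space E) (c_space E) (c0_space F) (c_space F) X2"
      unfolding admits_simultaneous_lifting_def by blast
  next
    assume "admits_simultaneous_lifting lam (\<lambda>x. x) lim_map
        (c0_space E) (c_space E) (c0_space F) (c_space F) X2"
    then obtain L :: "'a \<Rightarrow> nat \<Rightarrow>\<^sub>C 'a" where "bounded_linear L" "range L \<subseteq> c_space E"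
      "\<And>x. lim_map (L x) = x" "L ` X2 \<subseteq> c_space F" "onorm L \<le> lam"
      unfolding admits_simultaneous_lifting_def by blast
    then show "has_BAP_pair lam X2"
      by (rule BAP_pair_of_lifting[OF assms(4) lam])
  qed
qed

end
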